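(* Let $G$ be a connected bipartite simple graph with bipartition $(V_1,V_2)$ and edge cone $\mathbb{R}_+\mathcal{A}$. Then there is a unique irreducible representation $$\mathbb{R}_+\mathcal{A}=\mathrm{aff}(\mathbb{R}_+\mathcal{A})\cap\left(\bigcap_{i=1}^r H_{A_i}^-\right)\cap\left(\bigcap_{i\in\mathcal{I}}H_{e_i}^+\right)$$ such that $A_i\subsetneq V_1$ for all $i$ and $v_i\in V_2$ for all $i\in\mathcal{I}$.
   Context: Let $V(G)=\{v_1,\ldots,v_n\}$ and $e_i$ the $i$-th unit vector of $\mathbb{R}^n$. The edge cone $\mathbb{R}_+\mathcal{A}$ is the cone of nonnegative real combinations of the vectors $e_i+e_j$ with $\{v_i,v_j\}$ an edge of $G$; $\mathrm{aff}(\cdot)$ denotes affine hull. $N(A)$ is the set of vertices adjacent to some vertex of $A$. For $A\subset V_1$, $H_A^-=\{x\in\mathbb{R}^n\mid\sum_{v_i\in A}x_i\le\sum_{v_i\in N(A)}x_i\}$, and $H_{e_i}^+=\{x\mid x_i\ge 0\}$. A representation of a polyhedral cone $Q$ as $Q=\mathrm{aff}(Q)\cap\bigcap_{j=1}^s H_j$ with closed halfspaces $H_j$ is called irreducible if for each $j$, omitting $H_j$ from the intersection yields a set different from $Q$. *)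

theory Defs
  imports "HOL-Analysis.Analysis" "Graph_Theory.Graph_Theory"
begin

text \<open>
  A simple graph is a \<open>pair_graph\<close>: a finite, loopless, symmetric digraph without parallel arcs,
  where an edge \<open>{u, v}\<close> appears as the two arcs \<open>(u, v)\<close> and \<open>(v, u)\<close>.
  The graphs considered have the finite type \<open>'n\<close> as vertex set, so that the coordinates
  of \<open>real ^ 'n\<close> are indexed by the vertices and \<open>axis v 1\<close> is the unit vector belonging to \<open>v\<close>.
\<close>

definition bipartition :: "'n pair_pre_digraph \<Rightarrow> 'n set \<Rightarrow> 'n set \<Rightarrow> bool" where
  "bipartition G V1 V2 \<longleftrightarrow>
     V1 \<union> V2 = pverts G \<and> V1 \<inter> V2 = {} \<and>
     (\<forall>(u, v) \<in> parcs G. (u \<in> V1 \<and> v \<in> V2) \<or> (u \<in> V2 \<and> v \<in> V1))"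

definition nbhd :: "'n pair_pre_digraph \<Rightarrow> 'n set \<Rightarrow> 'n set" where
  "nbhd G A = {v. \<exists>u\<in>A. (u, v) \<in> parcs G}"

definition edge_vectors :: "'n::finite pair_pre_digraph \<Rightarrow> (real ^ 'n) set" where
  "edge_vectors G = {axis u 1 + axis v 1 | u v. (u, v) \<in> parcs G}"

definition edge_cone :: "'n::finite pair_pre_digraph \<Rightarrow> (real ^ 'n) set" where
  "edge_cone G = {\<Sum>a\<in>edge_vectors G. c a *\<^sub>R a | c. \<forall>a\<in>edge_vectors G. 0 \<le> c a}"

definition H_minus :: "'n::finite pair_pre_digraph \<Rightarrow> 'n set \<Rightarrow> (real ^ 'n) set" where
  "H_minus G A = {x. (\<Sum>v\<in>A. x $ v) \<le> (\<Sum>v\<in>nbhd G A. x $ v)}"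

definition H_plus :: "'n::finite \<Rightarrow> (real ^ 'n) set" where
  "H_plus v = {x. 0 \<le> x $ v}"

definition closed_halfspace :: "'a::euclidean_space set \<Rightarrow> bool" where
  "closed_halfspace H \<longleftrightarrow> (\<exists>a b. a \<noteq> 0 \<and> H = {x. a \<bullet> x \<le> b})"

text \<open>
  The halfspaces form a family \<open>H\<close> over a finite index set \<open>J\<close>; irreducibility is
  about omitting an index, so a family with a repeated halfspace is never irreducible.
\<close>

definition irreducible_representation ::
  "'a::euclidean_space set \<Rightarrow> 'i set \<Rightarrow> ('i \<Rightarrow> 'a set) \<Rightarrow> bool" where
  "irreducible_representation Q J H \<longleftrightarrow>
     finite J \<and> (\<forall>j\<in>J. closed_halfspace (H j)) \<and>
     Q = affine hull Q \<inter> (\<Inter>j\<in>J. H j) \<and>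
     (\<forall>j\<in>J. affine hull Q \<inter> (\<Inter>k\<in>J - {j}. H k) \<noteq> Q)"

text \<open>
  The family consisting of the \<open>H_minus G A\<close> for \<open>A \<in> \<A>\<close> and the \<open>H_plus v\<close> for \<open>v \<in> I\<close>
  is indexed by the disjoint union \<open>\<A> <+> I\<close>.
\<close>

definition irreducible_edge_cone_representation ::
  "'n::finite pair_pre_digraph \<Rightarrow> 'n set set \<Rightarrow> 'n set \<Rightarrow> bool" where
  "irreducible_edge_cone_representation G \<A> I \<longleftrightarrow>
     irreducible_representation (edge_cone G) (\<A> <+> I) (case_sum (H_minus G) H_plus)"

end

theory Submission
  imports Defs
begin

text \<open>
  By Farkas' lemma and a layer-cake argument, the inequalities of all \<open>H_minus G A\<close> with
  \<open>{} \<noteq> A \<subset> V1\<close> and of all \<open>H_plus v\<close> with \<open>v \<in> V2\<close> cut the edge cone out of its span; a minimal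
  subfamily is irreducible. In two irreducible representations the normals agree up to a positive
  factor on the cone. The normals in question take only the values \<open>0\<close> and \<open>1\<close> on the edge vectors,
  so the factor is \<open>1\<close>, and the difference of two such normals is \<open>t\<close> on \<open>V1\<close> and \<open>- t\<close> on \<open>V2\<close>
  because \<open>G\<close> is connected. Since the sets \<open>A\<close> are neither empty nor all of \<open>V1\<close>, the normals coincide.
\<close>

section \<open>Irreducible representations by halfspaces\<close>

text \<open>Redundant halfspaces are discarded one at a time; finiteness of \<open>T\<close> makes
  this stop, and then no index can be omitted.\<close>

lemma exists_irreducible_subrepresentation:
  assumes "finite T" and "\<And>j. j \<in> T \<Longrightarrow> closed_halfspace (H j)"
    and "Q = affine hull Q \<inter> (\<Inter>j\<in>T. H j)"
  obtains J where "J \<subseteq> T" "irreducible_representation Q J H"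
  using assms
proof (induction T arbitrary: thesis rule: finite_psubset_induct)
  case (psubset T)
  show thesis
  proof (cases "\<exists>j\<in>T. affine hull Q \<inter> (\<Inter>k\<in>T - {j}. H k) = Q")
    case True
    then obtain j where "j \<in> T" "affine hull Q \<inter> (\<Inter>k\<in>T - {j}. H k) = Q" by blast
    moreover have "T - {j} \<subset> T" using \<open>j \<in> T\<close> by blast
    ultimately obtain J where "J \<subseteq> T - {j}" "irreducible_representation Q J H"
      using psubset.IH[of "T - {j}"] psubset.prems(2) by (metis DiffD1)
    then show thesis using psubset.prems(1) by blast
  next
    case False
    then have "irreducible_representation Q T H"
      unfolding irreducible_representation_def
      using psubset.hyps(1) psubset.prems(2,3) by (intro conjI) simp_all
    then show thesis using psubset.prems(1) by blast
  qed
qed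

lemma irreducible_representation_mem_iff:
  assumes "irreducible_representation Q J H"
  shows "x \<in> Q \<longleftrightarrow> x \<in> affine hull Q \<and> (\<forall>i\<in>J. x \<in> H i)"
proof -
  have "Q = affine hull Q \<inter> (\<Inter>j\<in>J. H j)"
    using assms unfolding irreducible_representation_def by (elim conjE)
  then have "x \<in> Q \<longleftrightarrow> x \<in> affine hull Q \<inter> (\<Inter>j\<in>J. H j)" by (rule arg_cong)
  then show ?thesis by simp
qed

text \<open>If \<open>g j\<close> vanished on \<open>Q\<close>, it would vanish on
  \<open>affine hull Q\<close>; then \<open>H j\<close> would contain that hull and the index
  \<open>j\<close> could be omitted.\<close>

lemma irreducible_normal_pos:
  assumes irr: "irreducible_representation Q J H" and j: "j \<in> J"
    and H: "H j = {x. 0 \<le> g j \<bullet> x}"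
  obtains x where "x \<in> Q" "0 < g j \<bullet> x"
proof (rule ccontr)
  assume no: "\<not> thesis"
  note Q = irreducible_representation_mem_iff[OF irr]
  have ne: "affine hull Q \<inter> (\<Inter>k\<in>J - {j}. H k) \<noteq> Q"
    using irr j unfolding irreducible_representation_def by blast
  have "Q \<subseteq> {x. g j \<bullet> x = 0}"
  proof
    fix x assume "x \<in> Q"
    then have "0 \<le> g j \<bullet> x" "\<not> 0 < g j \<bullet> x" using Q[of x] j H no that by auto
    then show "x \<in> {x. g j \<bullet> x = 0}" by simp
  qed
  then have "affine hull Q \<subseteq> {x. g j \<bullet> x = 0}"
    by (rule hull_minimal) (rule affine_hyperplane)
  then have "x \<in> H j" if "x \<in> affine hull Q" for x using that H by auto
  then have "affine hull Q \<inter> (\<Inter>k\<in>J - {j}. H k) = Q" using Q by blast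
  then show False using ne by blast
qed

text \<open>The sum of one witness per index serves all indices at once, as the other summands
  contribute nonnegative values.\<close>

lemma convex_cone_common_pos:
  fixes g :: "'i \<Rightarrow> 'a::real_inner"
  assumes "convex_cone Q" "finite J"
    and "\<And>j x. j \<in> J \<Longrightarrow> x \<in> Q \<Longrightarrow> 0 \<le> g j \<bullet> x"
    and "\<And>j. j \<in> J \<Longrightarrow> \<exists>x\<in>Q. 0 < g j \<bullet> x"
  obtains y where "y \<in> Q" "\<And>j. j \<in> J \<Longrightarrow> 0 < g j \<bullet> y"
proof -
  have "\<exists>y\<in>Q. \<forall>j\<in>J. 0 < g j \<bullet> y"
    using assms(2-)
  proof (induction J)
    case empty
    then show ?case using convex_cone_nonempty[OF assms(1)] by auto
  next
    case (insert i J)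
    then obtain y where y: "y \<in> Q" "\<forall>j\<in>J. 0 < g j \<bullet> y" by (metis insertCI)
    obtain x where x: "x \<in> Q" "0 < g i \<bullet> x" using insert.prems(2)[of i] by blast
    have "x + y \<in> Q" using convex_cone_add[OF assms(1)] x y by blast
    moreover have "0 < g j \<bullet> (x + y)" if "j \<in> insert i J" for j
      using that x y insert.prems(1)[of j] 
      by (auto simp: inner_add_right intro: add_pos_nonneg add_nonneg_pos)
    ultimately show ?case by blast
  qed
  then show thesis using that by blast
qed

text \<open>Finitely many strict inequalities between continuous functions of \<open>t\<close>
  persist near \<open>0\<close>. The bound is two-sided so that a step can be taken along
  \<open>d\<close> and against it.\<close>

lemma small_step_pos:
  fixes g :: "'i \<Rightarrow> 'a::real_inner"
  assumes "finite J" "\<And>j. j \<in> J \<Longrightarrow> 0 < g j \<bullet> z"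
  obtains e :: real where "0 < e" "\<And>j t. j \<in> J \<Longrightarrow> \<bar>t\<bar> \<le> e \<Longrightarrow> 0 < g j \<bullet> (z + t *\<^sub>R d)"
proof -
  have "\<forall>\<^sub>F t in nhds (0::real). \<forall>j\<in>J. 0 < g j \<bullet> (z + t *\<^sub>R d)"
  proof (intro eventually_ball_finite assms ballI)
    fix j assume j: "j \<in> J"
    have "((\<lambda>t. g j \<bullet> (z + t *\<^sub>R d)) \<longlongrightarrow> g j \<bullet> (z + 0 *\<^sub>R d)) (nhds (0::real))"
      by (intro tendsto_intros filterlim_ident)
    then show "\<forall>\<^sub>F t in nhds (0::real). 0 < g j \<bullet> (z + t *\<^sub>R d)"
      by (rule order_tendstoD) (use assms j in simp)
  qed
  then obtain e where e: "0 < e" "\<And>t. \<bar>t\<bar> < e \<Longrightarrow> \<forall>j\<in>J. 0 < g j \<bullet> (z + t *\<^sub>R d)"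
    unfolding eventually_nhds_metric by (auto simp: dist_real_def)
  show thesis
  proof
    \<comment> \<open>Halving passes from the strict bound of the neighbourhood to the non-strict
      bound of the statement.\<close>
    show "0 < e / 2" using e by simp
    show "0 < g j \<bullet> (z + t *\<^sub>R d)" if "j \<in> J" "\<bar>t\<bar> \<le> e / 2" for j t
      using e that by (smt (verit) field_sum_of_halves)
  qed
qed

text \<open>
  Irreducibility of the first family provides a point \<open>z\<close> of \<open>Q\<close> at which only the
  \<open>j\<close>-th inequality is tight. Some inequality of the second family is tight at \<open>z\<close> as well, and it
  vanishes wherever the \<open>j\<close>-th one does.
\<close>

lemma irreducible_normals_proportional:
  fixes g :: "'i \<Rightarrow> 'a::euclidean_space"
  assumes cone: "convex_cone Q"
    and irrJ: "irreducible_representation Q J H" and irrK: "irreducible_representation Q K H"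
    and H: "\<And>i. i \<in> J \<union> K \<Longrightarrow> H i = {x. 0 \<le> g i \<bullet> x}"
    and j: "j \<in> J"
  obtains k c where "k \<in> K" "0 < c" "\<And>x. x \<in> Q \<Longrightarrow> g k \<bullet> x = c * (g j \<bullet> x)"
proof -
  define S where "S = affine hull Q"
  \<comment> \<open>The cone contains \<open>0\<close>, so its affine hull is a linear subspace, and
    all points constructed below stay in it.\<close>
  have S: "S = span Q"
    unfolding S_def using convex_cone_contains_0[OF cone] by (intro affine_hull_span_0 hull_inc)
  have sub: "subspace S" and QS: "Q \<subseteq> S" using S span_superset by auto
  have fin: "finite J" "finite K"
    and ne: "S \<inter> (\<Inter>i\<in>J - {j}. H i) \<noteq> Q"
    using irrJ irrK j unfolding irreducible_representation_def S_def by auto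
  have QJ: "x \<in> Q \<longleftrightarrow> x \<in> S \<and> (\<forall>i\<in>J. 0 \<le> g i \<bullet> x)" for x
    using irreducible_representation_mem_iff[OF irrJ] H by (simp add: S_def)
  have QK: "x \<in> Q \<longleftrightarrow> x \<in> S \<and> (\<forall>i\<in>K. 0 \<le> g i \<bullet> x)" for x
    using irreducible_representation_mem_iff[OF irrK] H by (simp add: S_def)
  have "\<exists>x\<in>Q. 0 < g i \<bullet> x" if "i \<in> J" for i
    using irreducible_normal_pos[OF irrJ that] H that by blast
  then obtain y where y: "y \<in> Q" "\<And>i. i \<in> J \<Longrightarrow> 0 < g i \<bullet> y"
    using convex_cone_common_pos[OF cone fin(1), of g] QJ by blast
  \<comment> \<open>Irreducibility at \<open>j\<close> yields a point of \<open>S\<close> that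
    violates the \<open>j\<close>-th inequality and no other one of \<open>J\<close>.\<close>
  obtain x where x: "x \<in> S" "\<And>i. i \<in> J - {j} \<Longrightarrow> 0 \<le> g i \<bullet> x" "g j \<bullet> x < 0"
  proof -
    have "Q \<subseteq> S \<inter> (\<Inter>i\<in>J - {j}. H i)" using QJ H by auto
    then obtain x where "x \<in> S \<inter> (\<Inter>i\<in>J - {j}. H i)" "x \<notin> Q" using ne by blast
    moreover from this have pos: "0 \<le> g i \<bullet> x" if "i \<in> J - {j}" for i using that H by auto
    ultimately have "\<not> 0 \<le> g j \<bullet> x" using QJ[of x] by auto
    then show thesis using that[of x] \<open>x \<in> S \<inter> _\<close> pos by auto
  qed
  \<comment> \<open>The parameter at which the segment from \<open>y\<close> to \<open>x\<close>
    crosses the hyperplane where \<open>g j\<close> vanishes.\<close>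
  define t where "t = g j \<bullet> y / (g j \<bullet> y - g j \<bullet> x)"
  have t: "0 < t" "t < 1" using y(2)[OF j] x(3) by (auto simp: t_def field_simps)
  define z where "z = y + t *\<^sub>R (x - y)"
  have zS: "z \<in> S"
    unfolding z_def using y x QS sub by (meson subsetD subspace_add subspace_diff subspace_scale)
  have zj: "g j \<bullet> z = 0"
    using y(2)[OF j] x(3) by (simp add: z_def t_def inner_add_right inner_diff_right field_simps)
  have zi: "0 < g i \<bullet> z" if "i \<in> J - {j}" for i
  proof -
    have "g i \<bullet> z = (1 - t) * (g i \<bullet> y) + t * (g i \<bullet> x)"
      by (simp add: z_def inner_add_right inner_diff_right algebra_simps)
    then show ?thesis using t y(2)[of i] x(2)[OF that] that by (simp add: add_pos_nonneg)
  qed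
  have zQ: "z \<in> Q" using zS zj zi QJ by (metis DiffI less_eq_real_def singletonD)
  \<comment> \<open>If all inequalities of \<open>K\<close> were strict at \<open>z\<close>, a short
    step further towards \<open>x\<close> would stay in \<open>Q\<close>, although
    \<open>g j\<close> is negative there.\<close>
  have "\<exists>k\<in>K. g k \<bullet> z = 0"
  proof (rule ccontr)
    assume "\<not> ?thesis"
    then have "0 < g k \<bullet> z" if "k \<in> K" for k using that zQ QK[of z] by (auto simp: less_le)
    then obtain e where e: "0 < e" "\<And>k t. k \<in> K \<Longrightarrow> \<bar>t\<bar> \<le> e \<Longrightarrow> 0 < g k \<bullet> (z + t *\<^sub>R (x - y))"
      using small_step_pos[OF fin(2)] by metis
    have "z + e *\<^sub>R (x - y) \<in> S"
      using zS y x QS sub by (meson subsetD subspace_add subspace_diff subspace_scale)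
    moreover have "\<forall>k\<in>K. 0 \<le> g k \<bullet> (z + e *\<^sub>R (x - y))"
      using e by (simp add: less_imp_le)
    ultimately have "z + e *\<^sub>R (x - y) \<in> Q" by (simp add: QK)
    then have "0 \<le> g j \<bullet> (z + e *\<^sub>R (x - y))" using QJ j by blast
    then have "0 \<le> e * (g j \<bullet> x - g j \<bullet> y)" using zj by (simp add: inner_add_right inner_diff_right)
    then show False using e(1) y(2)[OF j] x(3) by (simp add: zero_le_mult_iff)
  qed
  then obtain k where k: "k \<in> K" "g k \<bullet> z = 0" by blast
  \<comment> \<open>For small \<open>e\<close> the points \<open>z + e *\<^sub>R s\<close> and
    \<open>z - e *\<^sub>R s\<close> both lie in \<open>Q\<close>. There \<open>g k\<close> is
    nonnegative, and it is zero at \<open>z\<close>, so it vanishes at \<open>s\<close>.\<close>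
  have ker: "g k \<bullet> s = 0" if s: "s \<in> S" "g j \<bullet> s = 0" for s
  proof -
    obtain e where e: "0 < e" "\<And>i t. i \<in> J - {j} \<Longrightarrow> \<bar>t\<bar> \<le> e \<Longrightarrow> 0 < g i \<bullet> (z + t *\<^sub>R s)"
      using small_step_pos[of "J - {j}" g z s] fin zi by auto
    have "z + t *\<^sub>R s \<in> Q" if "\<bar>t\<bar> \<le> e" for t
    proof -
      have "0 \<le> g i \<bullet> (z + t *\<^sub>R s)" if "i \<in> J" for i
        using e(2)[of i t] \<open>\<bar>t\<bar> \<le> e\<close> that s(2) zj
        by (cases "i = j") (auto simp: inner_add_right less_imp_le)
      then show ?thesis using QJ zS s(1) sub by (simp add: subspace_add subspace_scale)
    qed
    from this[of e] this[of "- e"] have "0 \<le> g k \<bullet> (z + e *\<^sub>R s)" "0 \<le> g k \<bullet> (z + (- e) *\<^sub>R s)"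
      using QK k(1) e(1) by auto
    then have "0 \<le> e * (g k \<bullet> s)" "e * (g k \<bullet> s) \<le> 0" using k(2) by (auto simp: inner_add_right inner_diff_right)
    then show ?thesis using e(1) by (simp add: zero_le_mult_iff mult_le_0_iff)
  qed
  \<comment> \<open>The factor is read off at \<open>y\<close>. Subtracting from \<open>s\<close>
    the multiple of \<open>y\<close> with the same value of \<open>g j\<close> leaves a vector to
    which \<open>ker\<close> applies.\<close>
  define c where "c = g k \<bullet> y / (g j \<bullet> y)"
  have scaled: "g k \<bullet> s = c * (g j \<bullet> s)" if "s \<in> S" for s
  proof -
    have "s - (g j \<bullet> s / (g j \<bullet> y)) *\<^sub>R y \<in> S"
      using that y(1) QS sub by (meson subsetD subspace_diff subspace_scale)
    moreover have "g j \<bullet> (s - (g j \<bullet> s / (g j \<bullet> y)) *\<^sub>R y) = 0"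
      using y(2)[OF j] by (simp add: inner_diff_right)
    ultimately have "g k \<bullet> (s - (g j \<bullet> s / (g j \<bullet> y)) *\<^sub>R y) = 0" by (rule ker)
    then show ?thesis by (simp add: inner_diff_right c_def)
  qed
  have "0 \<le> c" using QK y k(1) j by (auto simp: c_def intro!: divide_nonneg_pos)
  \<comment> \<open>Otherwise \<open>g k\<close> would vanish on \<open>Q\<close>, against the
    irreducibility of the second family.\<close>
  moreover have "c \<noteq> 0"
  proof -
    obtain w where w: "w \<in> Q" "0 < g k \<bullet> w"
      using irreducible_normal_pos[OF irrK k(1), of g] H k(1) by blast
    then show ?thesis using scaled[of w] QS by auto
  qed
  ultimately have "0 < c" by simp
  moreover have "g k \<bullet> x = c * (g j \<bullet> x)" if "x \<in> Q" for x using scaled QS that by blast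
  ultimately show thesis using that k(1) by blast
qed

section \<open>Normals of the halfspaces and generators of the edge cone\<close>

text \<open>Inward normals, indexed by the same sum type as the halfspaces so that both kinds are
  handled uniformly.\<close>

definition facet_normal :: "'n::finite pair_pre_digraph \<Rightarrow> 'n set + 'n \<Rightarrow> real ^ 'n" where
  "facet_normal G = case_sum (\<lambda>A. (\<Sum>v\<in>nbhd G A. axis v 1) - (\<Sum>v\<in>A. axis v 1)) (\<lambda>v. axis v 1)"

lemma inner_sum_axis: "(\<Sum>v\<in>A. axis v 1) \<bullet> x = (\<Sum>v\<in>A. x $ v)" for x :: "real ^ 'n::finite"
  by (simp add: inner_sum_left inner_axis')

lemma facet_normal_inner:
  "facet_normal G (Inl A) \<bullet> x = (\<Sum>v\<in>nbhd G A. x $ v) - (\<Sum>v\<in>A. x $ v)"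
  "facet_normal G (Inr v) \<bullet> x = x $ v"
  by (simp_all add: facet_normal_def inner_diff_left inner_sum_axis inner_axis')

lemma sum_axis_nth: "(\<Sum>v\<in>A. axis v (1::real)) $ w = (if w \<in> A then 1 else 0)"
  for A :: "'n::finite set"
  by (simp add: axis_def sum_component)

lemma facet_normal_nth:
  "facet_normal G (Inl A) $ w = (if w \<in> nbhd G A then 1 else 0) - (if w \<in> A then 1 else 0)"
  "facet_normal G (Inr v) $ w = (if w = v then 1 else 0)"
  by (simp_all only: facet_normal_def sum.case vector_minus_component sum_axis_nth)
    (simp add: axis_def)

lemma case_sum_halfspace: "case_sum (H_minus G) H_plus i = {x. 0 \<le> facet_normal G i \<bullet> x}"
  by (cases i) (auto simp: H_minus_def H_plus_def facet_normal_inner)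

lemma closed_halfspace_inner_nonneg: "a \<noteq> 0 \<Longrightarrow> closed_halfspace {x. 0 \<le> a \<bullet> x}"
  unfolding closed_halfspace_def by (intro exI[of _ "- a"] exI[of _ 0]) auto

lemma finite_edge_vectors: "finite (edge_vectors G)"
proof -
  have "edge_vectors G \<subseteq> (\<lambda>(u, v). axis u 1 + axis v 1) ` UNIV"
    by (auto simp: edge_vectors_def)
  then show ?thesis by (rule finite_subset) simp
qed

text \<open>Gives access to closedness and minimality of generated cones; in particular a
  homogeneous linear inequality need only be checked on the edge vectors.\<close>

lemma edge_cone_eq_convex_cone_hull: "edge_cone G = convex_cone hull edge_vectors G"
proof (rule antisym)
  show "edge_cone G \<subseteq> convex_cone hull edge_vectors G"
  proof
    fix x assume "x \<in> edge_cone G"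
    then obtain c where c: "x = (\<Sum>a\<in>edge_vectors G. c a *\<^sub>R a)" "\<forall>a\<in>edge_vectors G. 0 \<le> c a"
      by (auto simp: edge_cone_def)
    have "F \<subseteq> edge_vectors G \<Longrightarrow> (\<Sum>a\<in>F. c a *\<^sub>R a) \<in> convex_cone hull edge_vectors G" if "finite F" for F
      using that
      by induction (use c in \<open>auto intro!: convex_cone_hull_add convex_cone_hull_mul
          convex_cone_hull_contains_0 intro: hull_inc\<close>)
    then show "x \<in> convex_cone hull edge_vectors G" using c finite_edge_vectors by blast
  qed
  have "convex_cone (edge_cone G)"
    unfolding convex_cone_iff
  proof (intro conjI allI ballI impI)
    show "0 \<in> edge_cone G" by (auto simp: edge_cone_def intro: exI[of _ "\<lambda>_. 0"])
    show "x + y \<in> edge_cone G" if xy: "x \<in> edge_cone G" "y \<in> edge_cone G" for x y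
    proof -
      obtain c where "x = (\<Sum>a\<in>edge_vectors G. c a *\<^sub>R a)" "\<forall>a\<in>edge_vectors G. 0 \<le> c a"
        using xy by (auto simp: edge_cone_def)
      moreover obtain d where "y = (\<Sum>a\<in>edge_vectors G. d a *\<^sub>R a)" "\<forall>a\<in>edge_vectors G. 0 \<le> d a"
        using xy by (auto simp: edge_cone_def)
      ultimately show ?thesis
        unfolding edge_cone_def
        by (auto intro!: exI[of _ "\<lambda>a. c a + d a"] simp: scaleR_add_left sum.distrib)
    qed
    show "t *\<^sub>R x \<in> edge_cone G" if xt: "x \<in> edge_cone G" "0 \<le> t" for x t
    proof -
      obtain c where "x = (\<Sum>a\<in>edge_vectors G. c a *\<^sub>R a)" "\<forall>a\<in>edge_vectors G. 0 \<le> c a"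
        using xt by (auto simp: edge_cone_def)
      then show ?thesis
        unfolding edge_cone_def
        using xt by (auto intro!: exI[of _ "\<lambda>a. t * c a"] simp: scaleR_sum_right)
    qed
  qed
  moreover have "edge_vectors G \<subseteq> edge_cone G"
  proof
    fix a assume "a \<in> edge_vectors G"
    then have "a = (\<Sum>b\<in>edge_vectors G. (if b = a then 1 else 0) *\<^sub>R b)"
      by (simp add: finite_edge_vectors if_distrib[of "\<lambda>r. r *\<^sub>R _"] cong: if_cong)
    then show "a \<in> edge_cone G"
      unfolding edge_cone_def by (auto intro!: exI[of _ "\<lambda>b. if b = a then 1 else 0"])
  qed
  ultimately show "convex_cone hull edge_vectors G \<subseteq> edge_cone G"
    by (intro hull_minimal)
qed

lemma affine_hull_edge_cone: "affine hull edge_cone G = span (edge_vectors G)"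
proof -
  have "affine hull edge_cone G = span (edge_cone G)"
    by (intro affine_hull_span_0 hull_inc)
      (simp add: edge_cone_eq_convex_cone_hull convex_cone_hull_contains_0)
  also have "\<dots> = span (edge_vectors G)"
  proof (rule antisym)
    have "edge_cone G \<subseteq> span (edge_vectors G)"
      unfolding edge_cone_eq_convex_cone_hull
      by (intro hull_minimal span_superset convex_cone_span)
    then show "span (edge_cone G) \<subseteq> span (edge_vectors G)" by (simp add: span_minimal)
    show "span (edge_vectors G) \<subseteq> span (edge_cone G)"
      unfolding edge_cone_eq_convex_cone_hull by (intro span_mono hull_subset)
  qed
  finally show ?thesis .
qed

section \<open>Weighted Hall inequalities\<close>

text \<open>
  A weight \<open>p\<close> decomposes into nonnegative multiples of indicator functions of its superlevel sets;
  the Hall-type inequalities handle each layer, and the induction peels off the lowest one.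
\<close>

lemma hall_weighted_nonneg:
  fixes x :: "'n::finite \<Rightarrow> real"
  assumes hall: "\<And>A. A \<subseteq> V1 \<Longrightarrow> (\<Sum>v\<in>A. x v) \<le> (\<Sum>v\<in>nbhd G A. x v)"
    and nbhd: "\<And>A. A \<subseteq> V1 \<Longrightarrow> nbhd G A \<subseteq> V2"
    and x: "\<And>v. v \<in> V2 \<Longrightarrow> 0 \<le> x v"
    and "\<And>u. u \<in> V1 \<Longrightarrow> 0 \<le> p u" and "\<And>v. v \<in> V2 \<Longrightarrow> 0 \<le> q v"
    and "\<And>u v. u \<in> V1 \<Longrightarrow> (u, v) \<in> parcs G \<Longrightarrow> p u \<le> q v"
  shows "(\<Sum>u\<in>V1. p u * x u) \<le> (\<Sum>v\<in>V2. q v * x v)"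
  using assms(4-)
proof (induction "card {u\<in>V1. 0 < p u}" arbitrary: p q rule: less_induct)
  case less
  define A where "A = {u\<in>V1. 0 < p u}"
  show ?case
  proof (cases "A = {}")
    case True
    then have "p u = 0" if "u \<in> V1" for u
      using that less.prems(1) A_def by (force simp: less_le)
    then have "(\<Sum>u\<in>V1. p u * x u) = 0" by simp
    also have "\<dots> \<le> (\<Sum>v\<in>V2. q v * x v)" using less.prems x by (intro sum_nonneg) simp
    finally show ?thesis .
  next
    case False
    \<comment> \<open>The smallest positive weight: lowering \<open>p\<close> by \<open>m\<close> on
      \<open>A\<close> keeps it nonnegative and removes at least \<open>u0\<close> from its
      support.\<close>
    define m where "m = Min (p ` A)"
    have m: "m \<le> p u" if "u \<in> A" for u using that by (simp add: m_def)
    have "m \<in> p ` A" unfolding m_def using False by (intro Min_in) auto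
    then obtain u0 where u0: "u0 \<in> A" "p u0 = m" by auto
    have mpos: "0 < m" using u0 by (auto simp: A_def)
    have AV: "A \<subseteq> V1" by (auto simp: A_def)
    define p' where "p' u = p u - (if u \<in> A then m else 0)" for u
    define q' where "q' v = q v - (if v \<in> nbhd G A then m else 0)" for v
    have pz: "p u = 0" if "u \<in> V1" "u \<notin> A" for u
      using that less.prems(1)[of u] by (auto simp: A_def)
    have q'0: "0 \<le> q' v" if "v \<in> V2" for v
    proof (cases "v \<in> nbhd G A")
      case True
      then obtain u where "u \<in> A" "(u, v) \<in> parcs G" by (auto simp: nbhd_def)
      then have "m \<le> q v" using m[of u] less.prems(3)[of u v] AV by force
      then show ?thesis using True by (simp add: q'_def)
    qed (use less.prems(2) that in \<open>simp add: q'_def\<close>)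
    have "{u\<in>V1. 0 < p' u} \<subset> {u\<in>V1. 0 < p u}"
    proof
      show "{u\<in>V1. 0 < p' u} \<subseteq> {u\<in>V1. 0 < p u}"
        using mpos by (auto simp: p'_def split: if_splits)
      have "u0 \<in> {u\<in>V1. 0 < p u}" "u0 \<notin> {u\<in>V1. 0 < p' u}"
        using u0 by (auto simp: p'_def A_def)
      then show "{u\<in>V1. 0 < p' u} \<noteq> {u\<in>V1. 0 < p u}" by blast
    qed
    then have "card {u\<in>V1. 0 < p' u} < card {u\<in>V1. 0 < p u}" by (intro psubset_card_mono) auto
    moreover have "0 \<le> p' u" if "u \<in> V1" for u
      using that m less.prems(1) by (auto simp: p'_def)
    moreover have "p' u \<le> q' v" if "u \<in> V1" "(u, v) \<in> parcs G" for u v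
    proof (cases "u \<in> A")
      case True
      then have "v \<in> nbhd G A" using that by (auto simp: nbhd_def)
      then show ?thesis using True less.prems(3)[OF that] by (simp add: p'_def q'_def)
    next
      case False
      \<comment> \<open>Outside \<open>A\<close> the weight \<open>p'\<close> is zero, so
        nonnegativity of \<open>q'\<close> is enough.\<close>
      have "v \<in> V2" using nbhd[of "{u}"] that by (auto simp: nbhd_def)
      then show ?thesis using pz[OF that(1) False] False q'0 by (simp add: p'_def)
    qed
    ultimately have IH: "(\<Sum>u\<in>V1. p' u * x u) \<le> (\<Sum>v\<in>V2. q' v * x v)"
      using less.hyps[of p' q'] q'0 by blast
    have split: "(\<Sum>u\<in>W. (f u - (if u \<in> B then m else 0)) * x u) = (\<Sum>u\<in>W. f u * x u) - m * (\<Sum>u\<in>B. x u)"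
      if "B \<subseteq> W" for f B W
    proof -
      have "(\<Sum>u\<in>W. (if u \<in> B then m else 0) * x u) = (\<Sum>u\<in>W. if u \<in> B then m * x u else 0)"
        by (intro sum.cong) auto
      also have "\<dots> = (\<Sum>u\<in>B. m * x u)"
        using that by (simp add: sum.If_cases Int_absorb1)
      finally show ?thesis by (simp add: left_diff_distrib sum_subtractf sum_distrib_left)
    qed
    \<comment> \<open>The removed layer satisfies the inequality by itself; the induction hypothesis
      covers the rest.\<close>
    have "m * (\<Sum>u\<in>A. x u) \<le> m * (\<Sum>v\<in>nbhd G A. x v)"
      using hall[OF AV] mpos by simp
    then show ?thesis
      using IH split[OF AV, of p] split[OF nbhd[OF AV], of q] by (simp add: p'_def q'_def)
  qed
qed

text \<open>By \<open>bal\<close>, raising all weights by the same \<open>t\<close> adds the same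
  amount to both sides, and a large \<open>t\<close> makes the weights nonnegative.\<close>

lemma hall_weighted:
  fixes x :: "'n::finite \<Rightarrow> real"
  assumes hall: "\<And>A. A \<subseteq> V1 \<Longrightarrow> (\<Sum>v\<in>A. x v) \<le> (\<Sum>v\<in>nbhd G A. x v)"
    and nbhd: "\<And>A. A \<subseteq> V1 \<Longrightarrow> nbhd G A \<subseteq> V2"
    and x: "\<And>v. v \<in> V2 \<Longrightarrow> 0 \<le> x v"
    and bal: "(\<Sum>u\<in>V1. x u) = (\<Sum>v\<in>V2. x v)"
    and pq: "\<And>u v. u \<in> V1 \<Longrightarrow> (u, v) \<in> parcs G \<Longrightarrow> p u \<le> q v"
  shows "(\<Sum>u\<in>V1. p u * x u) \<le> (\<Sum>v\<in>V2. q v * x v)"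
proof -
  define t where "t = (\<Sum>u\<in>UNIV. \<bar>p u\<bar>) + (\<Sum>v\<in>UNIV. \<bar>q v\<bar>)"
  have "\<bar>p u\<bar> \<le> t" "\<bar>q u\<bar> \<le> t" for u
    unfolding t_def
    by (smt (verit) UNIV_I abs_ge_zero finite member_le_sum sum_nonneg)+
  then have nn: "0 \<le> p u + t" "0 \<le> q u + t" for u by (smt (verit))+
  have "(\<Sum>u\<in>V1. (p u + t) * x u) \<le> (\<Sum>v\<in>V2. (q v + t) * x v)"
    by (rule hall_weighted_nonneg[OF hall nbhd x]) (use nn pq in auto)
  then show ?thesis
    using bal by (simp add: distrib_right sum.distrib flip: sum_distrib_left)
qed

section \<open>Inequalities describing the edge cone of a connected bipartite graph\<close>

locale connected_bipartite =
  fixes G :: "'n::finite pair_pre_digraph" and V1 V2 :: "'n set"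
  assumes graph: "pair_graph G"
    and verts: "pverts G = UNIV"
    and conn: "Digraph_Component.connected (with_proj G)"
    and bip: "bipartition G V1 V2"
begin

lemma arc_sym: "(u, v) \<in> parcs G \<Longrightarrow> (v, u) \<in> parcs G"
proof -
  interpret pair_graph G by (rule graph)
  show "(u, v) \<in> parcs G \<Longrightarrow> (v, u) \<in> parcs G"
    using pair_sym_arcs by (auto simp: symmetric_def dest: symD)
qed

lemma V_Un: "V1 \<union> V2 = UNIV" and V_disj: "V1 \<inter> V2 = {}"
  and arc_V: "(u, v) \<in> parcs G \<Longrightarrow> u \<in> V1 \<and> v \<in> V2 \<or> u \<in> V2 \<and> v \<in> V1"
  using bip verts by (auto simp: bipartition_def)

lemma nbhd_subset: "A \<subseteq> V1 \<Longrightarrow> nbhd G A \<subseteq> V2"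
  using arc_V V_disj by (fastforce simp: nbhd_def)

text \<open>The form in which connectedness is applied: the equality propagates along a walk in the
  symmetric closure.\<close>

lemma arc_invariant_const:
  assumes "\<And>u v. (u, v) \<in> parcs G \<Longrightarrow> h u = h v"
  shows "h u = h v"
proof -
  have "(u, v) \<in> rtrancl_on UNIV (parcs (mk_symmetric (with_proj G)))"
    using conn verts
    by (auto simp: connected_def strongly_connected_def reachable_def)
  then show ?thesis
    by induction (use assms in \<open>auto simp: parcs_mk_symmetric\<close>)
qed

lemma edge_vectors_eq: "edge_vectors G = {axis u 1 + axis v 1 | u v. u \<in> V1 \<and> v \<in> V2 \<and> (u, v) \<in> parcs G}"
proof (rule antisym)
  show "edge_vectors G \<subseteq> {axis u 1 + axis v 1 | u v. u \<in> V1 \<and> v \<in> V2 \<and> (u, v) \<in> parcs G}"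
  proof
    fix e assume "e \<in> edge_vectors G"
    then obtain u v where "e = axis u 1 + axis v 1" "(u, v) \<in> parcs G"
      by (auto simp: edge_vectors_def)
    then show "e \<in> {axis u 1 + axis v 1 | u v. u \<in> V1 \<and> v \<in> V2 \<and> (u, v) \<in> parcs G}"
      using arc_V[of u v] arc_sym[of u v] add.commute[of "axis u 1" "axis v 1 :: real ^ 'n"] by blast
  qed
qed (auto simp: edge_vectors_def)

text \<open>The difference of the two sums is linear and vanishes on every edge vector, since an
  edge has one end on each side.\<close>

lemma span_edge_vectors_balanced:
  assumes "x \<in> span (edge_vectors G)"
  shows "(\<Sum>v\<in>V1. x $ v) = (\<Sum>v\<in>V2. x $ v)"
proof -
  define a :: "real ^ 'n" where "a = (\<Sum>v\<in>V1. axis v 1) - (\<Sum>v\<in>V2. axis v 1)"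
  have a: "a \<bullet> y = (\<Sum>v\<in>V1. y $ v) - (\<Sum>v\<in>V2. y $ v)" for y
    by (simp add: a_def inner_diff_left inner_sum_axis)
  have "a \<bullet> (axis u 1 + axis v 1) = 0" if "u \<in> V1" "v \<in> V2" for u v
  proof -
    have "u \<notin> V2" "v \<notin> V1" using that V_disj by auto
    then have "a $ u = 1" "a $ v = - 1"
      using that by (simp_all only: a_def vector_minus_component sum_axis_nth) simp_all
    then show ?thesis by (simp add: inner_add_right inner_axis)
  qed
  then have "edge_vectors G \<subseteq> {y. a \<bullet> y = 0}" by (auto simp: edge_vectors_eq)
  then have "span (edge_vectors G) \<subseteq> {y. a \<bullet> y = 0}"
    by (rule span_minimal) (rule subspace_hyperplane)
  then show ?thesis using assms a by auto
qed

text \<open>Such a vertex occurs in no edge vector. This stands in for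
  \<open>nbhd G V1 = V2\<close>, which fails when the graph is a single vertex in
  \<open>V2\<close>.\<close>

lemma span_edge_vectors_isolated:
  assumes "x \<in> span (edge_vectors G)" "v \<in> V2" "v \<notin> nbhd G V1"
  shows "x $ v = 0"
proof -
  have "axis v 1 \<bullet> (axis u 1 + axis w 1 :: real ^ 'n) = 0"
    if "u \<in> V1" "w \<in> V2" "(u, w) \<in> parcs G" for u w
  proof -
    have "u \<noteq> v" "w \<noteq> v" using that assms(2,3) V_disj by (auto simp: nbhd_def)
    then show ?thesis by (simp add: inner_add_right inner_axis_axis)
  qed
  then have "edge_vectors G \<subseteq> {y. axis v 1 \<bullet> y = 0}" by (auto simp: edge_vectors_eq)
  then have "span (edge_vectors G) \<subseteq> {y. axis v 1 \<bullet> y = 0}"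
    by (rule span_minimal) (rule subspace_hyperplane)
  then show ?thesis using assms by (auto simp: inner_axis')
qed

text \<open>The value \<open>- 1\<close> cannot occur: if \<open>u\<close> lies in \<open>A\<close>,
  then \<open>v\<close> lies in \<open>nbhd G A\<close> and compensates.\<close>

lemma facet_normal_arc:
  assumes "i \<in> {A. A \<subset> V1} <+> V2" "u \<in> V1" "v \<in> V2" "(u, v) \<in> parcs G"
  shows "facet_normal G i \<bullet> (axis u 1 + axis v 1) \<in> {0, 1}"
proof (cases i)
  case (Inl A)
  then have "A \<subseteq> V1" using assms(1) by auto
  then have "u \<notin> nbhd G A" "v \<notin> A" "u \<in> A \<longrightarrow> v \<in> nbhd G A"
    using assms(2-4) nbhd_subset[of A] V_disj by (auto simp: nbhd_def)
  then show ?thesis using Inl by (auto simp: facet_normal_nth inner_add_right inner_axis)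
next
  case (Inr w)
  then show ?thesis
    using assms V_disj by (auto simp: facet_normal_nth inner_add_right inner_axis)
qed

text \<open>A vector \<open>a\<close> separating \<open>x\<close> from the closed cone is
  nonnegative on the edges, so the weights \<open>- a\<close> on \<open>V1\<close> and
  \<open>a\<close> on \<open>V2\<close> are admissible in \<open>hall_weighted\<close>. The result
  is \<open>0 \<le> a \<bullet> x\<close>, a contradiction.\<close>

lemma mem_edge_coneI:
  assumes span: "x \<in> span (edge_vectors G)"
    and pos: "\<And>v. v \<in> V2 \<Longrightarrow> 0 \<le> x $ v"
    and hall: "\<And>A. A \<subset> V1 \<Longrightarrow> A \<noteq> {} \<Longrightarrow> (\<Sum>v\<in>A. x $ v) \<le> (\<Sum>v\<in>nbhd G A. x $ v)"
  shows "x \<in> edge_cone G"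
proof (rule ccontr)
  assume "x \<notin> edge_cone G"
  moreover have "convex (edge_cone G)" "closed (edge_cone G)"
    by (simp_all add: edge_cone_eq_convex_cone_hull convex_convex_cone_hull closed_convex_cone_hull finite_edge_vectors)
  ultimately obtain a b where ab: "a \<bullet> x < b" "\<forall>y\<in>edge_cone G. b < a \<bullet> y"
    using separating_hyperplane_closed_point by blast
  have cone: "0 \<in> edge_cone G" "\<And>y t. y \<in> edge_cone G \<Longrightarrow> 0 \<le> t \<Longrightarrow> t *\<^sub>R y \<in> edge_cone G"
    by (simp_all add: edge_cone_eq_convex_cone_hull convex_cone_hull_contains_0 convex_cone_hull_mul)
  have b: "b < 0" using ab(2) cone(1) by force
  \<comment> \<open>A cone element with negative value could be scaled until its value is exactly
    \<open>b\<close>.\<close>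
  have nonneg: "0 \<le> a \<bullet> y" if "y \<in> edge_cone G" for y
  proof (rule ccontr)
    assume "\<not> 0 \<le> a \<bullet> y"
    then have "0 \<le> b / (a \<bullet> y)" "a \<bullet> ((b / (a \<bullet> y)) *\<^sub>R y) = b"
      using b by (auto simp: divide_nonpos_neg)
    then show False using ab(2) cone(2)[OF that] by force
  qed
  have arc: "- a $ u \<le> a $ v" if "u \<in> V1" "(u, v) \<in> parcs G" for u v
  proof -
    have "axis u 1 + axis v 1 \<in> edge_vectors G" using that by (auto simp: edge_vectors_def)
    then have "axis u 1 + axis v 1 \<in> edge_cone G"
      unfolding edge_cone_eq_convex_cone_hull by (rule hull_inc)
    from nonneg[OF this] show ?thesis by (simp add: inner_add_right inner_axis)
  qed
  have bal: "(\<Sum>v\<in>V1. x $ v) = (\<Sum>v\<in>V2. x $ v)" by (rule span_edge_vectors_balanced[OF span])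
  \<comment> \<open>Together with \<open>bal\<close> this settles the case \<open>A = V1\<close>,
    which \<open>hall\<close> leaves out.\<close>
  have "(\<Sum>v\<in>nbhd G V1. x $ v) = (\<Sum>v\<in>V2. x $ v)"
    using span_edge_vectors_isolated[OF span] nbhd_subset by (intro sum.mono_neutral_left) auto
  then have "(\<Sum>v\<in>A. x $ v) \<le> (\<Sum>v\<in>nbhd G A. x $ v)" if "A \<subseteq> V1" for A
    using hall[of A] bal that by (cases "A = {}"; cases "A = V1") (auto simp: nbhd_def)
  then have "(\<Sum>u\<in>V1. - a $ u * x $ u) \<le> (\<Sum>v\<in>V2. a $ v * x $ v)"
    using nbhd_subset pos bal arc
    by (intro hall_weighted[where G = G and p = "\<lambda>u. - a $ u" and q = "\<lambda>v. a $ v"]) auto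
  moreover have "a \<bullet> x = (\<Sum>v\<in>V1. a $ v * x $ v) + (\<Sum>v\<in>V2. a $ v * x $ v)"
    using sum.union_disjoint[of V1 V2 "\<lambda>v. a $ v * x $ v"] V_Un V_disj
    by (simp add: inner_vec_def)
  ultimately show False using ab(1) b by (simp add: sum_negf)
qed

text \<open>The empty set is excluded because its normal is zero and defines no halfspace, and
  \<open>V1\<close> because its inequality already holds on the span.\<close>

lemma edge_cone_halfspaces:
  "edge_cone G = affine hull edge_cone G \<inter>
     (\<Inter>i\<in>{A. A \<subset> V1 \<and> A \<noteq> {}} <+> V2. case_sum (H_minus G) H_plus i)" (is "_ = _ \<inter> ?R")
proof (rule antisym)
  have "edge_vectors G \<subseteq> {x. 0 \<le> facet_normal G i \<bullet> x}"
    if "i \<in> {A. A \<subset> V1 \<and> A \<noteq> {}} <+> V2" for i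
  proof
    fix e assume "e \<in> edge_vectors G"
    then obtain u v where "u \<in> V1" "v \<in> V2" "(u, v) \<in> parcs G" "e = axis u 1 + axis v 1"
      unfolding edge_vectors_eq by blast
    moreover have "i \<in> {A. A \<subset> V1} <+> V2" using that by blast
    ultimately have "facet_normal G i \<bullet> e \<in> {0, 1}" using facet_normal_arc by blast
    then show "e \<in> {x. 0 \<le> facet_normal G i \<bullet> x}" by auto
  qed
  then have "edge_cone G \<subseteq> {x. 0 \<le> facet_normal G i \<bullet> x}"
    if "i \<in> {A. A \<subset> V1 \<and> A \<noteq> {}} <+> V2" for i
    unfolding edge_cone_eq_convex_cone_hull using that
    by (intro hull_minimal convex_cone_halfspace_ge)
  then show "edge_cone G \<subseteq> affine hull edge_cone G \<inter> ?R"
    by (auto simp: case_sum_halfspace hull_inc)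
  show "affine hull edge_cone G \<inter> ?R \<subseteq> edge_cone G"
  proof
    fix x assume x: "x \<in> affine hull edge_cone G \<inter> ?R"
    show "x \<in> edge_cone G"
    proof (rule mem_edge_coneI)
      have ineq: "x \<in> case_sum (H_minus G) H_plus i" if "i \<in> {A. A \<subset> V1 \<and> A \<noteq> {}} <+> V2" for i
        using x that by blast
      show "x \<in> span (edge_vectors G)" using x by (simp add: affine_hull_edge_cone)
      show "0 \<le> x $ v" if "v \<in> V2" for v
        using ineq[of "Inr v"] that by (simp add: H_plus_def InrI)
      show "(\<Sum>v\<in>A. x $ v) \<le> (\<Sum>v\<in>nbhd G A. x $ v)" if "A \<subset> V1" "A \<noteq> {}" for A
        using ineq[of "Inl A"] that by (simp add: H_minus_def InlI)
    qed
  qed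
qed

section \<open>Uniqueness of the index sets\<close>

text \<open>On \<open>V1\<close> the normal of \<open>Inl A\<close> is \<open>- 1\<close> on
  \<open>A\<close> and \<open>0\<close> elsewhere, while that of \<open>Inr v\<close> is
  \<open>0\<close>. As the two normals differ by a constant on \<open>V1\<close>, a nonempty proper
  subset can be recognised; two indices of the form \<open>Inr\<close> are compared at
  \<open>e\<close>.\<close>

lemma facet_normal_inj:
  assumes j: "j \<in> {A. A \<subset> V1} <+> V2" and k: "k \<in> {A. A \<subset> V1} <+> V2"
    and "0 < c" and scaled: "\<And>e. e \<in> edge_vectors G \<Longrightarrow> facet_normal G k \<bullet> e = c * (facet_normal G j \<bullet> e)"
    and e: "e \<in> edge_vectors G" "0 < facet_normal G j \<bullet> e"
  shows "j = k"
proof -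
  obtain u0 v0 where uv: "u0 \<in> V1" "v0 \<in> V2" "(u0, v0) \<in> parcs G" "e = axis u0 1 + axis v0 1"
    using e(1) by (auto simp: edge_vectors_eq)
  have jk1: "facet_normal G j \<bullet> e = 1" "facet_normal G k \<bullet> e = 1"
    using facet_normal_arc[OF j uv(1-3)] facet_normal_arc[OF k uv(1-3)] scaled[OF e(1)] e(2) \<open>0 < c\<close> uv(4)
    by auto
  then have "c = 1" using scaled[OF e(1)] by simp
  define d where "d = facet_normal G k - facet_normal G j"
  have d: "d $ u = - d $ v" if "u \<in> V1" "(u, v) \<in> parcs G" for u v
  proof -
    have "axis u 1 + axis v 1 \<in> edge_vectors G" using that by (auto simp: edge_vectors_def)
    then have "d \<bullet> (axis u 1 + axis v 1) = 0"
      using scaled \<open>c = 1\<close> by (simp add: d_def inner_diff_left)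
    then show ?thesis by (simp add: inner_add_right inner_axis)
  qed
  \<comment> \<open>Flipping the sign off \<open>V1\<close> turns the alternation of
    \<open>d\<close> into invariance along arcs.\<close>
  define h where "h w = (if w \<in> V1 then d $ w else - d $ w)" for w
  have "h u = h v" if "(u, v) \<in> parcs G" for u v
    using arc_V[OF that]
  proof
    assume uv: "u \<in> V1 \<and> v \<in> V2"
    then have "v \<notin> V1" using V_disj by blast
    then show ?thesis using uv d[of u v] that by (simp add: h_def)
  next
    assume uv: "u \<in> V2 \<and> v \<in> V1"
    then have "u \<notin> V1" using V_disj by blast
    then show ?thesis using uv d[of v u] arc_sym[OF that] by (simp add: h_def)
  qed
  then have const: "d $ u = d $ v" if "u \<in> V1" "v \<in> V1" for u v
    using arc_invariant_const[of h u v] that by (simp add: h_def)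
  \<comment> \<open>The normal of the empty set is zero, but the value at \<open>e\<close> is
    \<open>1\<close>.\<close>
  have Inl_ne: "A \<noteq> {}" if "Inl A \<in> {j, k}" for A
    using that jk1 by (auto simp: facet_normal_inner nbhd_def)
  have d_Inl: "facet_normal G (Inl A) $ w = (if w \<in> A then - 1 else 0)" if "w \<in> V1" "A \<subset> V1" for A w
    using that nbhd_subset[of A] V_disj by (auto simp: facet_normal_nth)
  have d_Inr: "facet_normal G (Inr v) $ w = 0" if "w \<in> V1" "v \<in> V2" for v w
    using that V_disj by (auto simp: facet_normal_nth)
  \<comment> \<open>The normal of \<open>Inr v\<close> vanishes on \<open>V1\<close>, so that of
    \<open>Inl A\<close> would be constant there. The unordered pair covers both ways of assigning
    \<open>j\<close> and \<open>k\<close>.\<close>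
  have mixed: False if "A \<subset> V1" "A \<noteq> {}" "v \<in> V2" "{j, k} = {Inl A, Inr v}" for A v
  proof -
    obtain a a' where "a \<in> A" "a' \<in> V1" "a' \<notin> A" using \<open>A \<subset> V1\<close> \<open>A \<noteq> {}\<close> by blast
    moreover from this have "a \<in> V1" using \<open>A \<subset> V1\<close> by blast
    moreover have "facet_normal G (Inl A) $ a = facet_normal G (Inl A) $ a'"
      using const[of a a'] that \<open>a \<in> V1\<close> \<open>a' \<in> V1\<close> by (auto simp: d_def doubleton_eq_iff d_Inr)
    ultimately show False using d_Inl[of _ A] \<open>A \<subset> V1\<close> by simp
  qed
  consider (ll) A B where "j = Inl A" "k = Inl B" | (lr) A v where "{j, k} = {Inl A, Inr v}"
    | (rr) v w where "j = Inr v" "k = Inr w"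
    by (cases j; cases k) (auto simp: doubleton_eq_iff)
  then show ?thesis
  proof cases
    case ll
    then have AB: "A \<subset> V1" "B \<subset> V1" using j k by auto
    obtain a a' where a: "a \<in> A" "a' \<in> V1" "a' \<notin> A" using AB Inl_ne[of A] ll by blast
    then have aV: "a \<in> V1" using AB by blast
    have dd: "d $ w = (if w \<in> A then 1 else 0) - (if w \<in> B then 1 else 0)" if "w \<in> V1" for w
      using that AB by (simp add: d_def ll d_Inl)
    \<comment> \<open>\<open>d\<close> is \<open>0\<close> or \<open>1\<close> at \<open>a\<close>
      and \<open>0\<close> or \<open>- 1\<close> at \<open>a'\<close>; the two values agree, so both
      are \<open>0\<close>.\<close>
    have "d $ a = 0" using const[OF aV a(2)] dd[OF aV] dd[OF a(2)] a by (auto split: if_splits)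
    then have "w \<in> A \<longleftrightarrow> w \<in> B" if "w \<in> V1" for w
      using dd[OF that] const[OF aV that] by (auto split: if_splits)
    then show ?thesis using ll AB by blast
  next
    case lr
    then have "Inl A \<in> {j, k}" "Inr v \<in> {j, k}" by auto
    then show ?thesis using mixed[OF _ _ _ lr] j k Inl_ne by auto
  next
    case rr
    \<comment> \<open>Both vertices must be \<open>v0\<close>, the end of the edge \<open>e\<close>
      in \<open>V2\<close>.\<close>
    then show ?thesis using j k jk1 uv V_disj
      by (auto simp: facet_normal_inner axis_def split: if_splits)
  qed
qed

text \<open>Each normal of \<open>J\<close> is proportional on the cone to one of \<open>K\<close>,
  and \<open>facet_normal_inj\<close> identifies the two indices. The hypotheses are symmetric, so
  equality follows by exchanging \<open>J\<close> and \<open>K\<close>.\<close>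

lemma irreducible_index_subset:
  assumes J: "irreducible_representation (edge_cone G) J (case_sum (H_minus G) H_plus)"
    and K: "irreducible_representation (edge_cone G) K (case_sum (H_minus G) H_plus)"
    and "J \<subseteq> {A. A \<subset> V1} <+> V2" "K \<subseteq> {A. A \<subset> V1} <+> V2"
  shows "J \<subseteq> K"
proof
  fix j assume j: "j \<in> J"
  have edges: "edge_vectors G \<subseteq> edge_cone G"
    unfolding edge_cone_eq_convex_cone_hull by (rule hull_subset)
  have "convex_cone (edge_cone G)"
    by (simp add: edge_cone_eq_convex_cone_hull convex_cone_convex_cone_hull)
  then obtain k c where k: "k \<in> K" "0 < c"
    "\<And>x. x \<in> edge_cone G \<Longrightarrow> facet_normal G k \<bullet> x = c * (facet_normal G j \<bullet> x)"
    using irreducible_normals_proportional[OF _ J K case_sum_halfspace j] by blast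
  obtain x where x: "x \<in> edge_cone G" "0 < facet_normal G j \<bullet> x"
    using irreducible_normal_pos[OF J j, of "facet_normal G"] case_sum_halfspace by blast
  \<comment> \<open>A normal that is nonpositive on all edge vectors is nonpositive on the whole
    cone.\<close>
  obtain e where "e \<in> edge_vectors G" "0 < facet_normal G j \<bullet> e"
  proof (rule ccontr)
    assume "\<not> thesis"
    then have "edge_vectors G \<subseteq> {x. facet_normal G j \<bullet> x \<le> 0}" using that by force
    then have "edge_cone G \<subseteq> {x. facet_normal G j \<bullet> x \<le> 0}"
      unfolding edge_cone_eq_convex_cone_hull by (rule hull_minimal) (rule convex_cone_halfspace_le)
    then show False using x by fastforce
  qed
  then have "j = k" using facet_normal_inj[of j k c e] assms(3,4) j k edges by blast
  then show "j \<in> K" using k by simp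
qed

lemma irreducible_index_unique:
  assumes "irreducible_edge_cone_representation G \<A> I" "\<forall>A\<in>\<A>. A \<subset> V1" "I \<subseteq> V2"
    and "irreducible_edge_cone_representation G \<B> K" "\<forall>A\<in>\<B>. A \<subset> V1" "K \<subseteq> V2"
  shows "\<A> = \<B> \<and> I = K"
proof -
  have "\<A> <+> I \<subseteq> {A. A \<subset> V1} <+> V2" "\<B> <+> K \<subseteq> {A. A \<subset> V1} <+> V2" using assms by auto
  then have "\<A> <+> I = \<B> <+> K"
    using assms(1,4) irreducible_index_subset unfolding irreducible_edge_cone_representation_def
    by (intro antisym) auto
  then show ?thesis by (auto simp: set_eq_iff Plus_def image_iff)
qed

section \<open>Existence of the representation\<close>

lemma irreducible_index_exists:
  obtains \<A> I where "\<forall>A\<in>\<A>. A \<subset> V1" "I \<subseteq> V2" "irreducible_edge_cone_representation G \<A> I"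
proof -
  define T where "T = {A. A \<subset> V1 \<and> A \<noteq> {}} <+> V2"
  \<comment> \<open>A closed halfspace requires a nonzero normal; here a vertex of \<open>A\<close>,
    or \<open>v\<close> itself, gives a nonzero coordinate.\<close>
  have nz: "facet_normal G i \<noteq> 0" if "i \<in> T" for i
  proof (cases i)
    case (Inl A)
    then have A: "A \<subset> V1" "A \<noteq> {}" using that by (auto simp: T_def)
    then obtain a where "a \<in> A" by blast
    then have "facet_normal G i $ a = - 1"
      using A nbhd_subset[of A] V_disj Inl by (auto simp: facet_normal_nth)
    then show ?thesis by force
  next
    case (Inr v)
    then have "facet_normal G i $ v = 1" by (simp add: facet_normal_nth)
    then show ?thesis by force
  qed
  have "finite T" by (simp add: T_def)
  moreover have "closed_halfspace (case_sum (H_minus G) H_plus i)" if "i \<in> T" for i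
    using closed_halfspace_inner_nonneg[OF nz[OF that]] by (simp add: case_sum_halfspace)
  ultimately obtain J where J: "J \<subseteq> T"
    "irreducible_representation (edge_cone G) J (case_sum (H_minus G) H_plus)"
    using exists_irreducible_subrepresentation[OF _ _ edge_cone_halfspaces[folded T_def]] by blast
  \<comment> \<open>A subset of a sum type is the disjoint union of its two preimages, which serve
    as \<A> and \<open>I\<close>.\<close>
  have "i \<in> J \<longleftrightarrow> i \<in> {A. Inl A \<in> J} <+> {v. Inr v \<in> J}" for i
    by (cases i) auto
  then have J_eq: "J = {A. Inl A \<in> J} <+> {v. Inr v \<in> J}" by blast
  then have "irreducible_edge_cone_representation G {A. Inl A \<in> J} {v. Inr v \<in> J}"
    using J(2) by (simp add: irreducible_edge_cone_representation_def flip: J_eq)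
  moreover have "A \<subset> V1" if "Inl A \<in> J" for A using J(1) that by (auto simp: T_def)
  moreover have "v \<in> V2" if "Inr v \<in> J" for v using J(1) that by (auto simp: T_def)
  ultimately show thesis
    using that[of "{A. Inl A \<in> J}" "{v. Inr v \<in> J}"] by blast
qed

end

theorem theorem4p9:
  fixes G :: "'n::finite pair_pre_digraph" and V1 V2 :: "'n set"
  assumes "pair_graph G"
    and "pverts G = UNIV"
    and "Digraph_Component.connected (with_proj G)"
    and "bipartition G V1 V2"
  shows "\<exists>!(\<A>, I). (\<forall>A\<in>\<A>. A \<subset> V1) \<and> I \<subseteq> V2 \<and> irreducible_edge_cone_representation G \<A> I"
proof -
  interpret connected_bipartite G V1 V2 by (rule connected_bipartite.intro) (fact assms)+
  obtain \<A> I where "\<forall>A\<in>\<A>. A \<subset> V1" "I \<subseteq> V2" "irreducible_edge_cone_representation G \<A> I"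
    by (rule irreducible_index_exists)
  then show ?thesis
    by (intro ex1I[of _ "(\<A>, I)"]) (use irreducible_index_unique in \<open>auto split: prod.splits\<close>)
qed

end
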